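(* The function $\phi\colon\mathbf{G}\to\mathbb{C}$ is a 4-invariant.
   Context: All graphs are finite and simple; $\mathbf{G}$ is the set of isomorphism classes of finite simple graphs. $V(G)$, $E(G)$ are the vertex and edge sets of $G$. For $E'\subset E(G)$, $G|_{E'}$ is the spanning subgraph of $G$ with edge set $E'$ (same vertices). $\chi_3(H)$ is the number of proper colorings of the vertices of $H$ in three colors. Define $$\phi(G)=2^{-3|V(G)|}\sum_{E'\subset E(G)}(-2)^{|E'|}\chi_3(G|_{E'}).$$ Let $H$ be a finite simple graph with vertex set $W$ and let $a,b\subset W$ (not necessarily disjoint). Denote by $[H;a,b]_1$ (resp. $[H;a,b]_0$) the graph obtained from $H$ by adding two new vertices, the first adjacent in $W$ exactly to the vertices of $a$, the second adjacent in $W$ exactly to the vertices of $b$, with the two new vertices adjacent (resp. not adjacent) to each other. A function $g\colon\mathbf{G}\to\mathbb{C}$ is a *4-invariant* if for all such $H,a,b$ the graph 4T-relation $$g([H;a,b]_1)-g([H;a,b]_0)=g([H;a\triangle b,b]_1)-g([H;a\triangle b,b]_0)$$ holds, where $\triangle$ is symmetric difference. *)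

theory Defs
  imports Complex_Main "HOL-Library.FuncSet"
begin

datatype 'a graph = Graph (verts: "'a set") (edges: "'a set set")

definition simple_graph :: "'a graph \<Rightarrow> bool" where
  "simple_graph G \<longleftrightarrow> finite (verts G) \<and> (\<forall>e\<in>edges G. e \<subseteq> verts G \<and> card e = 2)"

definition spanning_subgraph :: "'a graph \<Rightarrow> 'a set set \<Rightarrow> 'a graph" where
  "spanning_subgraph G E' = Graph (verts G) E'"

text \<open>Colorings are extensional functions on the vertex set, so that each coloring of the
  vertices is counted exactly once.\<close>

definition proper_3_colorings :: "'a graph \<Rightarrow> ('a \<Rightarrow> nat) set" where
  "proper_3_colorings G =
     {c \<in> verts G \<rightarrow>\<^sub>E {..<3}. \<forall>u v. {u, v} \<in> edges G \<longrightarrow> c u \<noteq> c v}"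

definition chi3 :: "'a graph \<Rightarrow> nat" where
  "chi3 G = card (proper_3_colorings G)"

definition phi_graph :: "'a graph \<Rightarrow> complex" where
  "phi_graph G =
     (\<Sum>E'\<in>Pow (edges G). (-2) ^ card E' * of_nat (chi3 (spanning_subgraph G E')))
       / 2 ^ (3 * card (verts G))"

definition graph_iso :: "('a \<Rightarrow> 'b) \<Rightarrow> 'a graph \<Rightarrow> 'b graph \<Rightarrow> bool" where
  "graph_iso f G H \<longleftrightarrow> bij_betw f (verts G) (verts H) \<and>
     (\<forall>u\<in>verts G. \<forall>v\<in>verts G. {u, v} \<in> edges G \<longleftrightarrow> {f u, f v} \<in> edges H)"

definition isomorphic :: "'a graph \<Rightarrow> 'b graph \<Rightarrow> bool" where
  "isomorphic G H \<longleftrightarrow> simple_graph G \<and> simple_graph H \<and> (\<exists>f. graph_iso f G H)"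

lemma isomorphic_refl: "simple_graph G \<Longrightarrow> isomorphic G G"
  unfolding isomorphic_def graph_iso_def by (auto intro!: exI[of _ id])

lemma isomorphic_sym:
  assumes "isomorphic G H"
  shows "isomorphic H G"
proof -
  obtain f where G: "simple_graph G" and H: "simple_graph H" and f: "graph_iso f G H"
    using assms unfolding isomorphic_def by blast
  have bij: "bij_betw f (verts G) (verts H)"
    using f unfolding graph_iso_def by blast
  have "graph_iso (inv_into (verts G) f) H G"
    unfolding graph_iso_def
  proof (intro conjI ballI)
    show "bij_betw (inv_into (verts G) f) (verts H) (verts G)"
      using bij by (rule bij_betw_inv_into)
    fix u v assume uv: "u \<in> verts H" "v \<in> verts H"
    let ?u = "inv_into (verts G) f u" and ?v = "inv_into (verts G) f v"
    have "?u \<in> verts G" "?v \<in> verts G" "f ?u = u" "f ?v = v"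
      using bij uv by (auto simp: bij_betw_def inv_into_into f_inv_into_f)
    then show "{u, v} \<in> edges H \<longleftrightarrow> {?u, ?v} \<in> edges G"
      using f unfolding graph_iso_def by metis
  qed
  then show ?thesis
    using G H unfolding isomorphic_def by blast
qed

lemma isomorphic_trans:
  assumes "isomorphic G H" "isomorphic H K"
  shows "isomorphic G K"
proof -
  obtain f g where f: "graph_iso f G H" and g: "graph_iso g H K"
    using assms unfolding isomorphic_def by blast
  have "graph_iso (g \<circ> f) G K"
    unfolding graph_iso_def
  proof (intro conjI ballI)
    show "bij_betw (g \<circ> f) (verts G) (verts K)"
      using f g bij_betw_trans unfolding graph_iso_def by blast
    fix u v assume uv: "u \<in> verts G" "v \<in> verts G"
    then have "f u \<in> verts H" "f v \<in> verts H"
      using f bij_betwE unfolding graph_iso_def by blast+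
    then show "{u, v} \<in> edges G \<longleftrightarrow> {(g \<circ> f) u, (g \<circ> f) v} \<in> edges K"
      using f g uv unfolding graph_iso_def by simp
  qed
  then show ?thesis
    using assms unfolding isomorphic_def by blast
qed

lemma graph_iso_edges:
  assumes "simple_graph G" "simple_graph H" "graph_iso f G H"
  shows "bij_betw ((`) f) (edges G) (edges H)"
  unfolding bij_betw_def
proof (intro conjI)
  have bij: "bij_betw f (verts G) (verts H)"
    using assms(3) unfolding graph_iso_def by blast
  show "inj_on ((`) f) (edges G)"
    by (rule inj_on_subset[OF inj_on_image_Pow[of f "verts G"]])
      (use bij assms(1) in \<open>auto simp: bij_betw_def simple_graph_def\<close>)
  show "(`) f ` edges G = edges H"
  proof (intro equalityI subsetI)
    fix e assume "e \<in> (`) f ` edges G"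
    then obtain d where d: "d \<in> edges G" "e = f ` d"
      by blast
    then obtain u v where "u \<in> verts G" "v \<in> verts G" "d = {u, v}"
      using assms(1) unfolding simple_graph_def by (metis card_2_iff insert_subset)
    then show "e \<in> edges H"
      using assms(3) d unfolding graph_iso_def by auto
  next
    fix e assume e: "e \<in> edges H"
    then obtain x y where xy: "x \<in> verts H" "y \<in> verts H" "e = {x, y}"
      using assms(2) unfolding simple_graph_def by (metis card_2_iff insert_subset)
    then obtain u v where "u \<in> verts G" "v \<in> verts G" "x = f u" "y = f v"
      using bij unfolding bij_betw_def by blast
    then show "e \<in> (`) f ` edges G"
      using assms(3) e xy unfolding graph_iso_def by (auto intro!: image_eqI[of _ _ "{u, v}"])
  qed
qed

lemma chi3_le:
  assumes G: "simple_graph G" and H: "simple_graph H" and f: "graph_iso f G H"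
  shows "chi3 H \<le> chi3 G"
  unfolding chi3_def
proof (rule card_inj_on_le)
  have bij: "bij_betw f (verts G) (verts H)"
    using f unfolding graph_iso_def by blast
  let ?r = "\<lambda>c. restrict (c \<circ> f) (verts G)"
  show "inj_on ?r (proper_3_colorings H)"
  proof (rule inj_onI)
    fix c d assume c: "c \<in> proper_3_colorings H" and d: "d \<in> proper_3_colorings H"
      and eq: "?r c = ?r d"
    show "c = d"
    proof (rule PiE_ext[where k = "verts H" and s = "\<lambda>_. {..<3}"])
      show "c \<in> verts H \<rightarrow>\<^sub>E {..<3}" "d \<in> verts H \<rightarrow>\<^sub>E {..<3}"
        using c d unfolding proper_3_colorings_def by auto
      fix x assume "x \<in> verts H"
      then obtain u where u: "u \<in> verts G" "x = f u"
        using bij by (auto simp: bij_betw_def)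
      then show "c x = d x"
        using fun_cong[OF eq, of u] by simp
    qed
  qed
  show "?r ` proper_3_colorings H \<subseteq> proper_3_colorings G"
  proof (intro image_subsetI)
    fix c assume c: "c \<in> proper_3_colorings H"
    have "?r c \<in> verts G \<rightarrow>\<^sub>E {..<3}"
      using c bij_betwE[OF bij] unfolding proper_3_colorings_def by (auto dest!: PiE_mem)
    moreover have "?r c u \<noteq> ?r c v" if e: "{u, v} \<in> edges G" for u v
    proof -
      have uv: "u \<in> verts G" "v \<in> verts G"
        using G e unfolding simple_graph_def by blast+
      then have "{f u, f v} \<in> edges H"
        using f e unfolding graph_iso_def by blast
      then show ?thesis
        using c uv unfolding proper_3_colorings_def by simp
    qed
    ultimately show "?r c \<in> proper_3_colorings G"
      unfolding proper_3_colorings_def by blast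
  qed
  show "finite (proper_3_colorings G)"
    using G finite_PiE[of "verts G" "\<lambda>_. {..<3::nat}"]
    unfolding proper_3_colorings_def simple_graph_def by simp
qed

lemma chi3_isomorphic: "isomorphic G H \<Longrightarrow> chi3 G = chi3 H"
  by (metis chi3_le isomorphic_def isomorphic_sym le_antisym)

lemma phi_graph_isomorphic:
  assumes "isomorphic G H"
  shows "phi_graph G = phi_graph H"
proof -
  obtain f where G: "simple_graph G" and H: "simple_graph H" and f: "graph_iso f G H"
    using assms unfolding isomorphic_def by blast
  have bij: "bij_betw f (verts G) (verts H)"
    using f unfolding graph_iso_def by blast
  have ebij: "bij_betw ((`) f) (edges G) (edges H)"
    by (rule graph_iso_edges[OF G H f])
  have "(\<Sum>E'\<in>Pow (edges G). (-2) ^ card E' * of_nat (chi3 (spanning_subgraph G E'))) =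
        (\<Sum>E'\<in>Pow (edges H). (-2 :: complex) ^ card E' * of_nat (chi3 (spanning_subgraph H E')))"
    unfolding sum.reindex_bij_betw[OF bij_betw_Pow[OF ebij], symmetric]
  proof (rule sum.cong)
    fix D assume "D \<in> Pow (edges G)"
    then have D: "D \<subseteq> edges G"
      by simp
    have "card ((`) f ` D) = card D"
      using ebij D by (metis bij_betw_def card_image inj_on_subset)
    moreover have "isomorphic (spanning_subgraph G D) (spanning_subgraph H ((`) f ` D))"
      unfolding isomorphic_def
    proof (intro conjI exI)
      show "simple_graph (spanning_subgraph G D)"
        using G D unfolding simple_graph_def spanning_subgraph_def by auto
      show "simple_graph (spanning_subgraph H ((`) f ` D))"
        using H image_mono[OF D, of "(`) f"] ebij
        unfolding simple_graph_def spanning_subgraph_def bij_betw_def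
        by (metis graph.sel subsetD)
      have "{u, v} \<in> D \<longleftrightarrow> {f u, f v} \<in> (`) f ` D" if uv: "u \<in> verts G" "v \<in> verts G" for u v
      proof
        assume "{u, v} \<in> D"
        then show "{f u, f v} \<in> (`) f ` D"
          by (auto intro!: image_eqI[of _ _ "{u, v}"])
      next
        assume "{f u, f v} \<in> (`) f ` D"
        then obtain d where d: "d \<in> D" "f ` {u, v} = f ` d"
          by auto
        have "d \<subseteq> verts G"
          using d D G unfolding simple_graph_def by blast
        then have "{u, v} = d"
          using d(2) uv bij inj_on_image_eq_iff[of f "verts G" "{u, v}" d]
          unfolding bij_betw_def by blast
        then show "{u, v} \<in> D"
          using d by simp
      qed
      then show "graph_iso f (spanning_subgraph G D) (spanning_subgraph H ((`) f ` D))"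
        using bij unfolding graph_iso_def spanning_subgraph_def by simp
    qed
    ultimately show "(-2) ^ card D * of_nat (chi3 (spanning_subgraph G D)) =
        (-2 :: complex) ^ card ((`) f ` D) * of_nat (chi3 (spanning_subgraph H ((`) f ` D)))"
      by (simp add: chi3_isomorphic)
  qed simp
  then show ?thesis
    using bij_betw_same_card[OF bij] unfolding phi_graph_def by simp
qed

text \<open>Isomorphism classes of finite simple graphs. Every finite graph has an isomorphic copy on a
  set of natural numbers, so these represent all of them.\<close>

quotient_type graph_class = "nat graph" / partial: isomorphic
proof (rule part_equivpI)
  show "\<exists>G :: nat graph. isomorphic G G"
    by (rule exI[of _ "Graph {} {}"], rule isomorphic_refl) (simp add: simple_graph_def)
  show "symp (isomorphic :: nat graph \<Rightarrow> nat graph \<Rightarrow> bool)"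
    by (rule sympI) (rule isomorphic_sym)
  show "transp (isomorphic :: nat graph \<Rightarrow> nat graph \<Rightarrow> bool)"
    by (rule transpI) (rule isomorphic_trans)
qed

lift_definition phi :: "graph_class \<Rightarrow> complex" is phi_graph
  by (rule phi_graph_isomorphic)

text \<open>The graphs \<open>[H;a,b]\<^sub>1\<close> (for \<open>adj = True\<close>) and \<open>[H;a,b]\<^sub>0\<close> (for \<open>adj = False\<close>), where \<open>p\<close> and
  \<open>q\<close> are the first and the second new vertex; they are meant to be distinct and not in \<open>H\<close>.\<close>

definition add_two_vertices ::
    "'a graph \<Rightarrow> 'a \<Rightarrow> 'a \<Rightarrow> 'a set \<Rightarrow> 'a set \<Rightarrow> bool \<Rightarrow> 'a graph" where
  "add_two_vertices H p q a b adj =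
     Graph (verts H \<union> {p, q})
       (edges H \<union> {{p, x} | x. x \<in> a} \<union> {{q, x} | x. x \<in> b} \<union> (if adj then {{p, q}} else {}))"

lemma simple_graph_add_two_vertices:
  assumes "simple_graph H" "p \<notin> verts H" "q \<notin> verts H" "p \<noteq> q" "a \<subseteq> verts H" "b \<subseteq> verts H"
  shows "simple_graph (add_two_vertices H p q a b adj)"
proof -
  have "card {r, x} = 2" if "r \<notin> verts H" "x \<in> verts H" for r x
    using that by (auto simp: card_2_iff)
  then show ?thesis
    using assms unfolding simple_graph_def add_two_vertices_def by (auto simp: subset_iff)
qed

definition four_invariant :: "(graph_class \<Rightarrow> complex) \<Rightarrow> bool" where
  "four_invariant g \<longleftrightarrow>
     (\<forall>H a b p q. simple_graph H \<longrightarrow> a \<subseteq> verts H \<longrightarrow> b \<subseteq> verts H \<longrightarrow>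
        p \<notin> verts H \<longrightarrow> q \<notin> verts H \<longrightarrow> p \<noteq> q \<longrightarrow>
        g (abs_graph_class (add_two_vertices H p q a b True))
          - g (abs_graph_class (add_two_vertices H p q a b False))
        = g (abs_graph_class (add_two_vertices H p q (sym_diff a b) b True))
          - g (abs_graph_class (add_two_vertices H p q (sym_diff a b) b False)))"

end

theory Submission
  imports Defs
begin

text \<open>Exchanging the order of summation in \<open>phi\<close> turns it into a state sum. For a fixed map \<open>c\<close> from
  the vertices to three colors, the edge sets \<open>E'\<close> that contribute are those all of whose edges are
  bichromatic, and the sum of \<open>(-2) ^ card E'\<close> over them is the product over all edges of
  \<open>1 + (-2) = -1\<close> for a bichromatic and \<open>1\<close> for a monochromatic edge. Hence, up to the factor
  \<open>2 ^ (-3 n)\<close>, the invariant is the sum of these products over all, not necessarily proper, colorings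
  (lemma \<open>subgraph_sum_eq_state_sum\<close>).

  In the difference of the two graphs with and without the edge \<open>{p, q}\<close>, only colorings with
  \<open>c p \<noteq> c q\<close> survive, each with factor \<open>-2\<close> (lemma \<open>state_sum_edge_difference\<close>).
  On these, let \<open>k\<close> be the third color. For a vertex \<open>x\<close>, the product of its signs
  against the colors of \<open>p\<close> and \<open>q\<close> is its sign against the single color \<open>k\<close>.
  Signs square to \<open>1\<close>, so joining \<open>p\<close> to the symmetric difference of \<open>a\<close> and \<open>b\<close> instead of \<open>a\<close>
  multiplies the state by the signs between \<open>p\<close> and \<open>b\<close>, which has the effect of recoloring \<open>q\<close>
  from \<open>c q\<close> to \<open>k\<close>. Recoloring \<open>q\<close> by the third color is an involution of
  the surviving colorings, so the two sums agree.\<close>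

section \<open>The state sum\<close>

definition edge_sign :: "('a \<Rightarrow> nat) \<Rightarrow> 'a set \<Rightarrow> complex" where
  "edge_sign c e = (if card (c ` e) = 2 then -1 else 1)"

definition color_sign :: "nat \<Rightarrow> nat \<Rightarrow> complex" where
  "color_sign i j = (if i = j then 1 else -1)"

definition state_sum :: "'a graph \<Rightarrow> complex" where
  "state_sum G = (\<Sum>c\<in>verts G \<rightarrow>\<^sub>E {..<3}. \<Prod>e\<in>edges G. edge_sign c e)"

lemma edge_sign_pair: "edge_sign c {u, v} = color_sign (c u) (c v)"
  by (simp add: edge_sign_def color_sign_def)

lemma simple_graph_finite_edges: "simple_graph G \<Longrightarrow> finite (edges G)"
  unfolding simple_graph_def by (meson PowI finite_Pow_iff finite_subset subsetI)

lemma proper_3_colorings_spanning_subgraph: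
  assumes "simple_graph G" "E' \<subseteq> edges G"
  shows "proper_3_colorings (spanning_subgraph G E') =
    {c \<in> verts G \<rightarrow>\<^sub>E {..<3}. \<forall>e\<in>E'. card (c ` e) = 2}"
proof -
  have "(\<forall>u v. {u, v} \<in> E' \<longrightarrow> c u \<noteq> c v) \<longleftrightarrow> (\<forall>e\<in>E'. card (c ` e) = 2)"
    for c :: "'a \<Rightarrow> nat"
  proof (intro iffI ballI allI impI)
    fix e assume proper: "\<forall>u v. {u, v} \<in> E' \<longrightarrow> c u \<noteq> c v" and e: "e \<in> E'"
    then obtain u v where "e = {u, v}"
      using assms unfolding simple_graph_def by (metis card_2_iff subsetD)
    then show "card (c ` e) = 2"
      using proper e by simp
  next
    fix u v assume "\<forall>e\<in>E'. card (c ` e) = 2" "{u, v} \<in> E'"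
    then have "card (c ` {u, v}) = 2"
      by blast
    then show "c u \<noteq> c v"
      by auto
  qed
  then show ?thesis
    by (simp add: proper_3_colorings_def spanning_subgraph_def)
qed

text \<open>The product over the edges of \<open>1 + (-2) [e bichromatic]\<close> expands into the sum over all edge
  sets \<open>E'\<close> of \<open>(-2) ^ card E'\<close> times the indicator that \<open>c\<close> is proper on \<open>E'\<close>.\<close>

lemma subgraph_sum_eq_state_sum:
  assumes G: "simple_graph G"
  shows "(\<Sum>E'\<in>Pow (edges G). (-2) ^ card E' * of_nat (chi3 (spanning_subgraph G E')))
    = state_sum G"
proof -
  let ?C = "verts G \<rightarrow>\<^sub>E {..<3::nat}"
  let ?f = "\<lambda>c e. if card (c ` e) = 2 then -2 else (0::complex)"
  have finE: "finite (edges G)"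
    using G by (rule simple_graph_finite_edges)
  have finC: "finite ?C"
    using G by (auto simp: simple_graph_def intro!: finite_PiE)
  have term_eq: "(-2) ^ card E' * of_nat (chi3 (spanning_subgraph G E')) =
      (\<Sum>c\<in>?C. \<Prod>e\<in>E'. ?f c e)" if "E' \<in> Pow (edges G)" for E'
  proof -
    have sub: "E' \<subseteq> edges G"
      using that by simp
    have fin: "finite E'"
      using sub finE by (rule finite_subset)
    have prod_f: "(\<Prod>e\<in>E'. ?f c e) =
        (if \<forall>e\<in>E'. card (c ` e) = 2 then (-2) ^ card E' else 0)" for c :: "'a \<Rightarrow> nat"
      using fin by auto
    have "(\<Sum>c\<in>?C. \<Prod>e\<in>E'. ?f c e) =
        (\<Sum>c\<in>{c \<in> ?C. \<forall>e\<in>E'. card (c ` e) = 2}. (-2) ^ card E')"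
      unfolding prod_f by (rule sum.inter_filter[OF finC, symmetric])
    then show ?thesis
      unfolding chi3_def proper_3_colorings_spanning_subgraph[OF G sub]
      by (simp add: mult.commute)
  qed
  have "(\<Sum>E'\<in>Pow (edges G). (-2) ^ card E' * of_nat (chi3 (spanning_subgraph G E'))) =
      (\<Sum>E'\<in>Pow (edges G). \<Sum>c\<in>?C. \<Prod>e\<in>E'. ?f c e)"
    by (rule sum.cong[OF refl term_eq])
  also have "\<dots> = (\<Sum>c\<in>?C. \<Sum>E'\<in>Pow (edges G). \<Prod>e\<in>E'. ?f c e)"
    by (rule sum.swap)
  also have "\<dots> = (\<Sum>c\<in>?C. \<Prod>e\<in>edges G. ?f c e + 1)"
    using finE by (simp add: prod_add)
  also have "\<dots> = state_sum G"
    unfolding state_sum_def edge_sign_def by (intro sum.cong prod.cong) auto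
  finally show ?thesis .
qed

lemma phi_abs_graph_class:
  assumes "simple_graph G"
  shows "phi (abs_graph_class G) = state_sum G / 2 ^ (3 * card (verts G))"
  using phi.abs_eq[OF isomorphic_refl[OF assms]]
  by (simp add: phi_graph_def subgraph_sum_eq_state_sum[OF assms])

section \<open>Two additional vertices\<close>

definition two_vertex_weight ::
    "'a graph \<Rightarrow> 'a \<Rightarrow> 'a \<Rightarrow> 'a set \<Rightarrow> 'a set \<Rightarrow> ('a \<Rightarrow> nat) \<Rightarrow> complex" where
  "two_vertex_weight H p q a b c =
     (\<Prod>e\<in>edges H. edge_sign c e) * (\<Prod>x\<in>a. color_sign (c p) (c x))
       * (\<Prod>x\<in>b. color_sign (c q) (c x))"

lemma prod_star_edge_sign:
  assumes "r \<notin> a"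
  shows "(\<Prod>e\<in>{{r, x} | x. x \<in> a}. edge_sign c e) = (\<Prod>x\<in>a. color_sign (c r) (c x))"
proof -
  have "inj_on (\<lambda>x. {r, x}) a"
    by (auto simp: inj_on_def doubleton_eq_iff)
  moreover have "{{r, x} | x. x \<in> a} = (\<lambda>x. {r, x}) ` a"
    by auto
  ultimately show ?thesis
    by (simp add: prod.reindex edge_sign_pair)
qed

lemma prod_edge_sign_add_two_vertices:
  assumes H: "simple_graph H" and ab: "a \<subseteq> verts H" "b \<subseteq> verts H"
    and pq: "p \<notin> verts H" "q \<notin> verts H" "p \<noteq> q"
  shows "(\<Prod>e\<in>edges (add_two_vertices H p q a b adj). edge_sign c e) =
    two_vertex_weight H p q a b c * (if adj then color_sign (c p) (c q) else 1)"
proof -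
  let ?A = "{{p, x} | x. x \<in> a}" and ?B = "{{q, x} | x. x \<in> b}"
    and ?P = "if adj then {{p, q}} else {}"
  have fin: "finite (edges H)" "finite ?A" "finite ?B"
    using H ab simple_graph_finite_edges[OF H]
    by (auto simp: simple_graph_def Setcompr_eq_image intro: finite_subset)
  have sub: "e \<subseteq> verts H" if "e \<in> edges H" for e
    using H that by (simp add: simple_graph_def)
  have disj: "edges H \<inter> ?A = {}" "(edges H \<union> ?A) \<inter> ?B = {}" "(edges H \<union> ?A \<union> ?B) \<inter> ?P = {}"
    using sub ab pq by (auto simp: doubleton_eq_iff subset_iff split: if_splits)
  have P: "(\<Prod>e\<in>?P. edge_sign c e) = (if adj then color_sign (c p) (c q) else 1)"
    by (simp add: edge_sign_pair)
  have "p \<notin> a" "q \<notin> b"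
    using ab pq by auto
  then show ?thesis
    using fin disj
    by (simp add: add_two_vertices_def prod.union_disjoint prod_star_edge_sign P
        two_vertex_weight_def)
qed

text \<open>In the difference, the weight of a coloring is multiplied by the sign of \<open>{p, q}\<close>, decreased by
  \<open>1\<close>: this factor is \<open>0\<close> if the edge is monochromatic and \<open>-2\<close> if it is bichromatic.\<close>

lemma state_sum_edge_difference:
  assumes "simple_graph H" "a \<subseteq> verts H" "b \<subseteq> verts H"
    and "p \<notin> verts H" "q \<notin> verts H" "p \<noteq> q"
  shows "state_sum (add_two_vertices H p q a b True) - state_sum (add_two_vertices H p q a b False)
    = -2 * (\<Sum>c\<in>{c \<in> verts H \<union> {p, q} \<rightarrow>\<^sub>E {..<3}. c p \<noteq> c q}. two_vertex_weight H p q a b c)"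
proof -
  let ?C = "verts H \<union> {p, q} \<rightarrow>\<^sub>E {..<3::nat}"
  have fin: "finite ?C"
    using assms(1) by (auto simp: simple_graph_def intro!: finite_PiE)
  have verts: "verts (add_two_vertices H p q a b adj) = verts H \<union> {p, q}" for adj
    by (simp add: add_two_vertices_def)
  have "state_sum (add_two_vertices H p q a b True) - state_sum (add_two_vertices H p q a b False)
      = (\<Sum>c\<in>?C. two_vertex_weight H p q a b c * color_sign (c p) (c q)
                  - two_vertex_weight H p q a b c)"
    unfolding state_sum_def verts prod_edge_sign_add_two_vertices[OF assms]
    by (simp add: sum_subtractf)
  also have "\<dots> = (\<Sum>c\<in>?C. if c p \<noteq> c q then -2 * two_vertex_weight H p q a b c else 0)"
    by (intro sum.cong) (auto simp: color_sign_def)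
  also have "\<dots> = (\<Sum>c\<in>{c \<in> ?C. c p \<noteq> c q}. -2 * two_vertex_weight H p q a b c)"
    by (rule sum.inter_filter[OF fin, symmetric])
  finally show ?thesis
    by (simp only: sum_distrib_left)
qed

section \<open>Recoloring by the third color\<close>

text \<open>The three colors add up to \<open>3\<close>, so \<open>3 - i - j\<close> is the third one. If \<open>m\<close> is \<open>i\<close> or \<open>j\<close>, exactly one
  sign on the left is \<open>-1\<close>; if \<open>m\<close> is the third color, both are.\<close>

lemma color_sign_third:
  assumes "i < 3" "j < 3" "i \<noteq> j" "m < 3"
  shows "color_sign i m * color_sign j m = color_sign (3 - i - j) m"
proof -
  have "i \<in> {0, 1, 2}" "j \<in> {0, 1, 2}" "m \<in> {0, 1, 2}"
    using assms by auto
  then show ?thesis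
    using assms(3) by (auto simp: color_sign_def)
qed

lemma prod_sym_diff_of_involutive:
  fixes f :: "'a \<Rightarrow> 'b::comm_monoid_mult"
  assumes fin: "finite A" "finite B" and sq: "\<And>x. x \<in> A \<inter> B \<Longrightarrow> f x * f x = 1"
  shows "prod f (sym_diff A B) = prod f A * prod f B"
proof -
  have A: "prod f A = prod f (A - B) * prod f (A \<inter> B)"
    using fin by (metis Diff_Diff_Int Int_lower1 Diff_subset mult.commute prod.subset_diff)
  have B: "prod f B = prod f (B - A) * prod f (A \<inter> B)"
    using fin by (metis Diff_Diff_Int Int_commute Diff_subset mult.commute prod.subset_diff)
  have I: "prod f (A \<inter> B) * prod f (A \<inter> B) = 1"
    unfolding prod.distrib[symmetric] by (rule prod.neutral) (use sq in blast)
  have "prod f A * prod f B =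
      prod f (A - B) * prod f (B - A) * (prod f (A \<inter> B) * prod f (A \<inter> B))"
    unfolding A B by (simp only: ac_simps)
  also have "\<dots> = prod f (sym_diff A B)"
    unfolding I using fin by (subst prod.union_disjoint) auto
  finally show ?thesis ..
qed

text \<open>Passing from \<open>a\<close> to the symmetric difference multiplies the weight by the signs of \<open>b\<close> against
  the color of \<open>p\<close>; together with the signs against the color of \<open>q\<close> they are the signs against the
  third color.\<close>

lemma two_vertex_weight_sym_diff:
  assumes H: "simple_graph H" and ab: "a \<subseteq> verts H" "b \<subseteq> verts H"
    and pq: "p \<notin> verts H" "q \<notin> verts H" "p \<noteq> q"
    and c: "c \<in> verts H \<union> {p, q} \<rightarrow>\<^sub>E {..<3}" "c p \<noteq> c q"
  shows "two_vertex_weight H p q (sym_diff a b) b c =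
    two_vertex_weight H p q a b (c(q := 3 - c p - c q))"
proof -
  let ?c = "c(q := 3 - c p - c q)"
  have fin: "finite a" "finite b"
    using H ab by (auto simp: simple_graph_def intro: finite_subset)
  have lt: "c x < 3" if "x \<in> verts H \<union> {p, q}" for x
    using c(1) that by (auto dest: PiE_mem)
  have c_q: "?c x = c x" if "x \<in> verts H" for x
    using that pq by auto
  have old: "(\<Prod>e\<in>edges H. edge_sign ?c e) = (\<Prod>e\<in>edges H. edge_sign c e)"
  proof (rule prod.cong[OF refl])
    fix e assume "e \<in> edges H"
    then have "e \<subseteq> verts H"
      using H by (simp add: simple_graph_def)
    then have "?c ` e = c ` e"
      using c_q by (intro image_cong) blast+
    then show "edge_sign ?c e = edge_sign c e"
      by (simp add: edge_sign_def)
  qed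
  have star_a: "(\<Prod>x\<in>a. color_sign (?c p) (?c x)) = (\<Prod>x\<in>a. color_sign (c p) (c x))"
    using ab pq by (intro prod.cong) auto
  have "(\<Prod>x\<in>b. color_sign (c p) (c x)) * (\<Prod>x\<in>b. color_sign (c q) (c x)) =
      (\<Prod>x\<in>b. color_sign (c p) (c x) * color_sign (c q) (c x))"
    by (simp add: prod.distrib)
  also have "\<dots> = (\<Prod>x\<in>b. color_sign (?c q) (?c x))"
  proof (rule prod.cong[OF refl])
    fix x assume "x \<in> b"
    then have "x \<in> verts H"
      using ab by blast
    then show "color_sign (c p) (c x) * color_sign (c q) (c x) = color_sign (?c q) (?c x)"
      using color_sign_third[of "c p" "c q" "c x"] lt c(2) c_q by simp
  qed
  finally have star_b: "(\<Prod>x\<in>b. color_sign (c p) (c x)) * (\<Prod>x\<in>b. color_sign (c q) (c x)) =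
      (\<Prod>x\<in>b. color_sign (?c q) (?c x))" .
  have "(\<Prod>x\<in>sym_diff a b. color_sign (c p) (c x)) =
      (\<Prod>x\<in>a. color_sign (c p) (c x)) * (\<Prod>x\<in>b. color_sign (c p) (c x))"
    by (rule prod_sym_diff_of_involutive[OF fin]) (simp add: color_sign_def)
  then show ?thesis
    unfolding two_vertex_weight_def old star_a star_b[symmetric] by (simp only: mult.assoc)
qed

lemma sum_two_vertex_weight_sym_diff:
  assumes "simple_graph H" "a \<subseteq> verts H" "b \<subseteq> verts H"
    and pq: "p \<notin> verts H" "q \<notin> verts H" "p \<noteq> q"
  defines "C \<equiv> {c \<in> verts H \<union> {p, q} \<rightarrow>\<^sub>E {..<3}. c p \<noteq> c q}"
  shows "(\<Sum>c\<in>C. two_vertex_weight H p q a b c) =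
    (\<Sum>c\<in>C. two_vertex_weight H p q (sym_diff a b) b c)"
proof -
  let ?r = "\<lambda>c. c(q := 3 - c p - c q)"
  have closed: "?r c \<in> C" and inv: "?r (?r c) = c" if "c \<in> C" for c
  proof -
    have c: "c \<in> verts H \<union> {p, q} \<rightarrow>\<^sub>E {..<3}" "c p < 3" "c q < 3" "c p \<noteq> c q"
      using that by (auto simp: C_def dest: PiE_mem)
    have "?r c \<in> verts H \<union> {p, q} \<rightarrow>\<^sub>E {..<3}"
      using c by (auto simp: PiE_iff extensional_def)
    \<comment> \<open>If \<open>3 - c p - c q\<close> were \<open>c p\<close>, then \<open>c q = 3 - 2 * c p\<close>: the colors \<open>0\<close> and \<open>2\<close> for \<open>p\<close>
      put \<open>c q\<close> out of range, and \<open>1\<close> makes it equal to \<open>c p\<close>.\<close>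
    moreover have "c p \<noteq> 3 - c p - c q"
      using c(2-4) by presburger
    ultimately show "?r c \<in> C"
      using pq by (simp add: C_def)
    have "3 - c p - (3 - c p - c q) = c q"
      using c(2-4) by linarith
    then show "?r (?r c) = c"
      using pq by (simp add: fun_eq_iff)
  qed
  have weight: "two_vertex_weight H p q (sym_diff a b) b c = two_vertex_weight H p q a b (?r c)"
    if "c \<in> C" for c
    using two_vertex_weight_sym_diff[OF assms(1-6)] that unfolding C_def by blast
  show ?thesis
    by (rule sum.reindex_bij_witness[of C ?r ?r]) (simp_all only: closed inv weight)
qed

theorem theorem3p7: "four_invariant phi"
  unfolding four_invariant_def
proof (intro allI impI)
  fix H :: "nat graph" and a b :: "nat set" and p q :: nat
  assume H: "simple_graph H" and a: "a \<subseteq> verts H" and b: "b \<subseteq> verts H"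
    and pq: "p \<notin> verts H" "q \<notin> verts H" "p \<noteq> q"
  have d: "sym_diff a b \<subseteq> verts H"
    using a b by blast
  have phi_eq: "phi (abs_graph_class (add_two_vertices H p q s b adj)) =
      state_sum (add_two_vertices H p q s b adj) / 2 ^ (3 * card (verts H \<union> {p, q}))"
    if "s \<subseteq> verts H" for s adj
    using phi_abs_graph_class[OF simple_graph_add_two_vertices[OF H pq that b]]
    by (simp add: add_two_vertices_def)
  show "phi (abs_graph_class (add_two_vertices H p q a b True))
          - phi (abs_graph_class (add_two_vertices H p q a b False))
        = phi (abs_graph_class (add_two_vertices H p q (sym_diff a b) b True))
          - phi (abs_graph_class (add_two_vertices H p q (sym_diff a b) b False))"
    unfolding phi_eq[OF a] phi_eq[OF d] diff_divide_distrib[symmetric]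
      state_sum_edge_difference[OF H a b pq] state_sum_edge_difference[OF H d b pq]
      sum_two_vertex_weight_sym_diff[OF H a b pq] ..
qed

end
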